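(* Let $(I,J,K)$ be a reduced triple and let $\mathcal{V}$ be the corresponding variety of Wajsberg hoops, i.e. $\mathcal{V}=\mathsf{V}(\{\mathbf{S}_i:i\in I\}\cup\{\mathbf{S}_j^\omega:j\in J\})$ if $K=\emptyset$, and $\mathcal{V}=\mathsf{V}(\{\mathbf{S}_i:i\in I\}\cup\{\mathbf{S}^\omega\})$ if $K=\{0\}$. For each multiplicative separation $\Pi=(I_1,I_2,J_1,J_2)$ of $(I,J,K)$ there exists a term $t_\Pi(x)$ in the language $\{\cdot,\to,\top\}$, which can be effectively calculated, such that - $\mathbf{S}_i\vDash t_\Pi(x)\approx x$ and $\mathbf{S}_j^\omega\vDash t_\Pi(x)\approx x$ for all $i\in I_1$, $j\in J_1$; - $\mathbf{S}_i\vDash t_\Pi(x)\approx x^i$ for all $i\in I_2$; - $\mathbf{S}_j^\omega\vDash t_\Pi(x)\approx x\cdot((x^{j+1}\to x^{2(j+1)})\to x^{j+1})$ for all $j\in J_2$; - if $K=\{0\}$, then $\mathbf{S}^\omega\vDash t_\Pi(x)\approx x$. Hence, $t_\Pi(x)$ is a multiplicative conucleus on $\mathcal{V}$.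
   Context: A hoop is an algebra $\langle A,\cdot,\to,\top\rangle$ such that $\langle A,\cdot,\top\rangle$ is a commutative monoid and $x\to x=\top$, $x\cdot(x\to y)=y\cdot(y\to x)$, $x\to(y\to z)=(x\cdot y)\to z$; it is partially ordered by $x\le y$ iff $x\to y=\top$. A Wajsberg hoop is a hoop satisfying $(x\to y)\to y\approx(y\to x)\to x$. $\mathsf{V}(\mathcal{K})$ is the variety generated by $\mathcal{K}$. Powers: $a^0=\top$, $a^{n+1}=a^n\cdot a$. $\mathbb{N}=\{1,2,\dots\}$, $\mathbb{N}_0=\mathbb{N}\cup\{0\}$. A multiplicative conucleus on a hoop $\mathbf{A}$ is a map $\delta\colon A\to A$ that is an interior operator ($\delta(a)\le a$, $\delta$ monotone, $\delta\delta=\delta$) with $\delta(a\cdot b)=\delta(a)\cdot\delta(b)$ for all $a,b$. A term $t(x)$ is a multiplicative conucleus on a variety $\mathcal{V}$ if its interpretation $t^{\mathbf{A}}$ is a multiplicative conucleus on $\mathbf{A}$ for every $\mathbf{A}\in\mathcal{V}$. Wajsberg hoops used: - For $n\in\mathbb{N}$, $\mathbf{S}_n$ has universe $\{0,\frac1n,\dots,\frac{n-1}n,1\}$, with $x\cdot y=\max\{x+y-1,0\}$, $x\to y=\min\{y-x+1,1\}$, $\top=1$. - $\mathbf{S}^\omega=\langle\mathbb{N}_0,+,\to,0\rangle$ with $i\to j=\max\{j-i,0\}$ (so $+$ plays the role of $\cdot$ and $0$ of $\top$). - For $n\in\mathbb{N}$, $\mathbf{S}_n^\omega$ has universe the interval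 $[(0,0),(n,0)]$ of $\mathbb{Z}^2$ in the lexicographic order, with $x\cdot y=\neg(\neg x\oplus\neg y)$, $x\to y=\neg x\oplus y$, $\top=(n,0)$, where $x\oplus y=\min\{x+y,(n,0)\}$ and $\neg x=(n,0)-x$. A reduced triple is $(I,J,K)$ with $I,J$ finite subsets of $\mathbb{N}$ and $K\subseteq\{0\}$ such that: $I\cup J\cup K\ne\emptyset$; if $K=\{0\}$ then $J=\emptyset$; for all $i\in I$ and $i'\in(I\setminus\{i\})\cup J$, $i$ does not divide $i'$; for all $j\in J$ and $j'\in J\setminus\{j\}$, $j$ does not divide $j'$. A multiplicative separation of $(I,J,K)$ is a tuple $(I_1,I_2,J_1,J_2)$ with $I_1,I_2\subseteq I$, $J_1,J_2\subseteq J$, $I_1\cup I_2=I$, $I_1\cap I_2=\emptyset$, $(J_1,J_2)\in\{(J,\emptyset),(\emptyset,J)\}$, and $\gcd(k,l)=1$ for all $k\in I_1\cup J_1$, $l\in I_2\cup J_2$. "Effectively calculated" means that there is an algorithm producing $t_\Pi(x)$ from the finite data $(I,J,K)$ and $\Pi$. *)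

theory Defs
  imports
    "HOL-Algebra.Group"
    "HOL-Library.Nat_Bijection"
    "HOL-Library.Product_Plus"
    "HOL-Library.Product_Lexorder"
    Complex_Main
begin

section \<open>Hoops\<close>

text \<open>
  The monoid part of the signature is the one of HOL-Algebra: \<open>\<otimes>\<close> is the product and \<open>\<one>\<close> is
  the constant \<open>\<top>\<close>.
\<close>

record 'a hoop_alg = "'a monoid" +
  resid :: "'a \<Rightarrow> 'a \<Rightarrow> 'a"  (infixr "\<leadsto>\<index>" 60)

locale hoop = comm_monoid A for A (structure) +
  assumes resid_closed [intro, simp]: "\<lbrakk>x \<in> carrier A; y \<in> carrier A\<rbrakk> \<Longrightarrow> x \<leadsto> y \<in> carrier A"
    and resid_self: "x \<in> carrier A \<Longrightarrow> x \<leadsto> x = \<one>"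
    and divisibility: "\<lbrakk>x \<in> carrier A; y \<in> carrier A\<rbrakk> \<Longrightarrow> x \<otimes> (x \<leadsto> y) = y \<otimes> (y \<leadsto> x)"
    and resid_resid: "\<lbrakk>x \<in> carrier A; y \<in> carrier A; z \<in> carrier A\<rbrakk>
           \<Longrightarrow> x \<leadsto> (y \<leadsto> z) = (x \<otimes> y) \<leadsto> z"

definition hoop_le :: "('a, 'm) hoop_alg_scheme \<Rightarrow> 'a \<Rightarrow> 'a \<Rightarrow> bool"  (infix "\<preceq>\<index>" 50) where
  "x \<preceq>\<^bsub>A\<^esub> y \<longleftrightarrow> x \<leadsto>\<^bsub>A\<^esub> y = \<one>\<^bsub>A\<^esub>"

locale multiplicative_conucleus = hoop A for A (structure) +
  fixes \<delta> :: "'a \<Rightarrow> 'a"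
  assumes closed: "a \<in> carrier A \<Longrightarrow> \<delta> a \<in> carrier A"
    and contracting: "a \<in> carrier A \<Longrightarrow> \<delta> a \<preceq> a"
    and monotone: "\<lbrakk>a \<in> carrier A; b \<in> carrier A; a \<preceq> b\<rbrakk> \<Longrightarrow> \<delta> a \<preceq> \<delta> b"
    and idempotent: "a \<in> carrier A \<Longrightarrow> \<delta> (\<delta> a) = \<delta> a"
    and multiplicative: "\<lbrakk>a \<in> carrier A; b \<in> carrier A\<rbrakk> \<Longrightarrow> \<delta> (a \<otimes> b) = \<delta> a \<otimes> \<delta> b"

section \<open>Terms, equations and generated varieties\<close>

datatype 'v hterm =
    Var 'v
  | Top
  | Mult "'v hterm" "'v hterm"  (infixl "\<^bold>\<cdot>" 70)
  | Imp "'v hterm" "'v hterm"  (infixr "\<^bold>\<rightarrow>" 60)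

primrec eval :: "('a, 'm) hoop_alg_scheme \<Rightarrow> ('v \<Rightarrow> 'a) \<Rightarrow> 'v hterm \<Rightarrow> 'a" where
  "eval A v (Var i) = v i"
| "eval A v Top = \<one>\<^bsub>A\<^esub>"
| "eval A v (s \<^bold>\<cdot> t) = eval A v s \<otimes>\<^bsub>A\<^esub> eval A v t"
| "eval A v (s \<^bold>\<rightarrow> t) = eval A v s \<leadsto>\<^bsub>A\<^esub> eval A v t"

primrec tpow :: "'v hterm \<Rightarrow> nat \<Rightarrow> 'v hterm" where
  "tpow t 0 = Top"
| "tpow t (Suc n) = tpow t n \<^bold>\<cdot> t"

definition satisfies :: "('a, 'm) hoop_alg_scheme \<Rightarrow> 'v hterm \<Rightarrow> 'v hterm \<Rightarrow> bool"
    ("(_ \<Turnstile> _ \<approx> _)" [51, 51, 51] 50) where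
  "A \<Turnstile> s \<approx> t \<longleftrightarrow> (\<forall>v. range v \<subseteq> carrier A \<longrightarrow> eval A v s = eval A v t)"

definition models :: "('a, 'm) hoop_alg_scheme \<Rightarrow> ('v hterm \<times> 'v hterm) set \<Rightarrow> bool" where
  "models A E \<longleftrightarrow> (\<forall>(s, t) \<in> E. A \<Turnstile> s \<approx> t)"

text \<open>
  Unary terms \<open>t(x)\<close> are the terms over the one-element set of variables; \<open>term_fun A t\<close> is the
  interpretation of \<open>t\<close> in \<open>A\<close>.
\<close>

type_synonym unary_hterm = "unit hterm"

abbreviation X :: unary_hterm where
  "X \<equiv> Var ()"

definition term_fun :: "('a, 'm) hoop_alg_scheme \<Rightarrow> unary_hterm \<Rightarrow> 'a \<Rightarrow> 'a" where
  "term_fun A t a = eval A (\<lambda>_. a) t"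

definition algebra :: "('a, 'm) hoop_alg_scheme \<Rightarrow> bool" where
  "algebra A \<longleftrightarrow> \<one>\<^bsub>A\<^esub> \<in> carrier A \<and>
     (\<forall>x \<in> carrier A. \<forall>y \<in> carrier A. x \<otimes>\<^bsub>A\<^esub> y \<in> carrier A \<and> x \<leadsto>\<^bsub>A\<^esub> y \<in> carrier A)"

section \<open>The generating Wajsberg hoops\<close>

definition S :: "nat \<Rightarrow> real hoop_alg" where
  "S n = \<lparr>carrier = {real k / real n | k. k \<le> n},
          mult = (\<lambda>x y. max (x + y - 1) 0),
          one = 1,
          resid = (\<lambda>x y. min (y - x + 1) 1)\<rparr>"

text \<open>Truncated subtraction on the natural numbers is \<open>max {j - i, 0}\<close>.\<close>

definition S_cancel :: "nat hoop_alg"  ("S\<^sup>\<omega>") where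
  "S\<^sup>\<omega> = \<lparr>carrier = UNIV, mult = (+), one = 0, resid = (\<lambda>i j. j - i)\<rparr>"

text \<open>
  On \<open>int \<times> int\<close>, addition is componentwise (Product_Plus) and the order, hence also \<open>min\<close> and the
  interval below, is lexicographic (Product_Lexorder).
\<close>

definition lplus :: "nat \<Rightarrow> int \<times> int \<Rightarrow> int \<times> int \<Rightarrow> int \<times> int" where
  "lplus n x y = min (x + y) (int n, 0)"

definition lneg :: "nat \<Rightarrow> int \<times> int \<Rightarrow> int \<times> int" where
  "lneg n x = (int n, 0) - x"

definition S_lex :: "nat \<Rightarrow> (int \<times> int) hoop_alg"  ("S\<^sup>\<omega>\<^sub>_" [1000] 1000) where
  "S_lex n = \<lparr>carrier = {(0, 0)..(int n, 0)},
              mult = (\<lambda>x y. lneg n (lplus n (lneg n x) (lneg n y))),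
              one = (int n, 0),
              resid = (\<lambda>x y. lplus n (lneg n x) y)\<rparr>"

section \<open>Reduced triples, their varieties, and multiplicative separations\<close>

definition reduced_triple :: "nat set \<Rightarrow> nat set \<Rightarrow> nat set \<Rightarrow> bool" where
  "reduced_triple I J K \<longleftrightarrow>
     finite I \<and> finite J \<and> I \<subseteq> {1..} \<and> J \<subseteq> {1..} \<and> K \<subseteq> {0} \<and>
     I \<union> J \<union> K \<noteq> {} \<and>
     (K = {0} \<longrightarrow> J = {}) \<and>
     (\<forall>i \<in> I. \<forall>i' \<in> (I - {i}) \<union> J. \<not> i dvd i') \<and>
     (\<forall>j \<in> J. \<forall>j' \<in> J - {j}. \<not> j dvd j')"

definition multiplicative_separation ::
    "nat set \<Rightarrow> nat set \<Rightarrow> nat set \<Rightarrow> nat set \<Rightarrow> nat set \<Rightarrow> nat set \<Rightarrow> bool" where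
  "multiplicative_separation I J I\<^sub>1 I\<^sub>2 J\<^sub>1 J\<^sub>2 \<longleftrightarrow>
     I\<^sub>1 \<subseteq> I \<and> I\<^sub>2 \<subseteq> I \<and> J\<^sub>1 \<subseteq> J \<and> J\<^sub>2 \<subseteq> J \<and>
     I\<^sub>1 \<union> I\<^sub>2 = I \<and> I\<^sub>1 \<inter> I\<^sub>2 = {} \<and>
     (J\<^sub>1, J\<^sub>2) \<in> {(J, {}), ({}, J)} \<and>
     (\<forall>k \<in> I\<^sub>1 \<union> J\<^sub>1. \<forall>l \<in> I\<^sub>2 \<union> J\<^sub>2. gcd k l = 1)"

definition generators_model ::
    "nat set \<Rightarrow> nat set \<Rightarrow> nat set \<Rightarrow> ('v hterm \<times> 'v hterm) set \<Rightarrow> bool" where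
  "generators_model I J K E \<longleftrightarrow>
     (\<forall>i \<in> I. models (S i) E) \<and>
     (K = {} \<longrightarrow> (\<forall>j \<in> J. models S\<^sup>\<omega>\<^sub>j E)) \<and>
     (K = {0} \<longrightarrow> models S\<^sup>\<omega> E)"

text \<open>
  \<open>A\<close> belongs to the variety generated by a class of algebras iff it belongs to every equational
  class that contains all the generators. An equational class is given by a set \<open>E\<close> of equations
  in countably many variables. Working with \<open>E\<close> rather than with a class of algebras is what
  allows the generators and \<open>A\<close> to have different carrier types.
\<close>

definition variety :: "nat set \<Rightarrow> nat set \<Rightarrow> nat set \<Rightarrow> 'a hoop_alg set"  ("\<V>") where
  "\<V> I J K = {A. algebra A \<and>
     (\<forall>E :: (nat hterm \<times> nat hterm) set. generators_model I J K E \<longrightarrow> models A E)}"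

definition separation_term ::
    "nat set \<Rightarrow> nat set \<Rightarrow> nat set \<Rightarrow> nat set \<Rightarrow> nat set \<Rightarrow> unary_hterm \<Rightarrow> bool" where
  "separation_term K I\<^sub>1 I\<^sub>2 J\<^sub>1 J\<^sub>2 t \<longleftrightarrow>
     (\<forall>i \<in> I\<^sub>1. S i \<Turnstile> t \<approx> X) \<and>
     (\<forall>j \<in> J\<^sub>1. S\<^sup>\<omega>\<^sub>j \<Turnstile> t \<approx> X) \<and>
     (\<forall>i \<in> I\<^sub>2. S i \<Turnstile> t \<approx> tpow X i) \<and>
     (\<forall>j \<in> J\<^sub>2. S\<^sup>\<omega>\<^sub>j \<Turnstile> t \<approx> X \<^bold>\<cdot> ((tpow X (j + 1) \<^bold>\<rightarrow> tpow X (2 * (j + 1))) \<^bold>\<rightarrow> tpow X (j + 1))) \<and>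
     (K = {0} \<longrightarrow> S\<^sup>\<omega> \<Turnstile> t \<approx> X)"

section \<open>Effective calculability\<close>

text \<open>
  \<open>total_recursive n f\<close>: the restriction of \<open>f\<close> to argument lists of length \<open>n\<close> is a total recursive
  function. The rule \<open>mu\<close> is minimisation of regular functions, which suffices (Kleene) to
  generate all total recursive functions without going through partial ones. The rule \<open>ext\<close> makes
  the behaviour on lists of other lengths irrelevant.
\<close>

inductive total_recursive :: "nat \<Rightarrow> (nat list \<Rightarrow> nat) \<Rightarrow> bool" where
  zero: "total_recursive n (\<lambda>xs. 0)"
| succ: "total_recursive 1 (\<lambda>xs. Suc (xs ! 0))"
| proj: "i < n \<Longrightarrow> total_recursive n (\<lambda>xs. xs ! i)"
| comp: "\<lbrakk>total_recursive (length gs) f; \<And>g. g \<in> set gs \<Longrightarrow> total_recursive n g\<rbrakk>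
    \<Longrightarrow> total_recursive n (\<lambda>xs. f (map (\<lambda>g. g xs) gs))"
| prec: "\<lbrakk>total_recursive n f; total_recursive (Suc (Suc n)) g\<rbrakk>
    \<Longrightarrow> total_recursive (Suc n) (\<lambda>xs. rec_nat (f (tl xs)) (\<lambda>k r. g (k # r # tl xs)) (hd xs))"
| mu: "\<lbrakk>total_recursive (Suc n) f; \<And>xs. length xs = n \<Longrightarrow> \<exists>y. f (y # xs) = 0\<rbrakk>
    \<Longrightarrow> total_recursive n (\<lambda>xs. LEAST y. f (y # xs) = 0)"
| ext: "\<lbrakk>total_recursive n f; \<And>xs. length xs = n \<Longrightarrow> f xs = g xs\<rbrakk> \<Longrightarrow> total_recursive n g"

text \<open>Goedel numbering of unary terms; finite sets of naturals are coded by \<open>set_encode\<close>.\<close>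

primrec term_code :: "unary_hterm \<Rightarrow> nat" where
  "term_code (Var u) = 0"
| "term_code Top = 1"
| "term_code (s \<^bold>\<cdot> t) = 2 * prod_encode (term_code s, term_code t) + 2"
| "term_code (s \<^bold>\<rightarrow> t) = 2 * prod_encode (term_code s, term_code t) + 3"

lemma term_code_eq_iff: "term_code s = term_code t \<longleftrightarrow> s = t"
proof
  show "s = t" if "term_code s = term_code t"
    using that
  proof (induction s arbitrary: t)
    case (Var u)
    then show ?case by (cases t) auto
  next
    case Top
    then show ?case by (cases t) auto
  next
    case (Mult s1 s2)
    then show ?case by (cases t) (auto, presburger+)
  next
    case (Imp s1 s2)
    then show ?case by (cases t) (auto, presburger+)
  qed
qed simp

end

theory Submission
  imports Defs
begin

text \<open>
  Let \<open>L\<close> be the product of the elements of \<open>I\<^sub>2 \<union> J\<^sub>2\<close>. It is a multiple of each of them and is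
  coprime to the elements of \<open>I\<^sub>1 \<union> J\<^sub>1\<close>. So if \<open>a\<close> is the first component of an element of
  \<open>S_lex p\<close> with \<open>0 < a < p\<close>, the residue of \<open>- L a\<close> modulo \<open>p\<close> is \<open>0\<close> for \<open>p \<in> I\<^sub>2 \<union> J\<^sub>2\<close> and is
  positive for \<open>p \<in> I\<^sub>1 \<union> J\<^sub>1\<close>. Repeated subtraction modulo \<open>p\<close> is given by a term independent of
  \<open>p\<close>, which turns this into a test that multiplies \<open>x\<close> by \<open>0\<close> or \<open>\<top>\<close>. The elements
  infinitely close to \<open>\<top>\<close> form a cancellative hoop, where every such test is made to give
  \<open>\<top>\<close>. That the result is a conucleus is a set of equations, because by divisibility a
  multiplicative map below the identity is monotone.
\<close>

section \<open>Hoops\<close>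

context hoop
begin

text \<open>Residuation puts each side below the other, and divisibility makes the order
  antisymmetric.\<close>

lemma one_resid: assumes "x \<in> carrier A" shows "\<one> \<leadsto> x = x"
proof -
  let ?y = "\<one> \<leadsto> x"
  have y: "?y \<in> carrier A" using assms by simp
  have "x \<leadsto> ?y = \<one>" using assms by (simp add: resid_resid resid_self)
  moreover have "?y \<leadsto> x = \<one>"
    using resid_self[OF y] resid_resid[OF y one_closed assms] y by simp
  ultimately show ?thesis using divisibility[OF assms y] assms y by simp
qed

lemma resid_one: assumes "x \<in> carrier A" shows "x \<leadsto> \<one> = \<one>"
proof -
  let ?p = "x \<leadsto> \<one>"
  have p: "?p \<in> carrier A" using assms by simp
  \<comment> \<open>\<open>x\<close> absorbs \<open>?p\<close>, so residuation turns
    \<open>?p\<close> into \<open>?p \<leadsto> ?p\<close>.\<close>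
  have xp: "x \<otimes> ?p = x" using divisibility[OF assms one_closed] one_resid assms by simp
  have "?p = (?p \<otimes> x) \<leadsto> \<one>" using xp assms p by (simp add: m_comm)
  also have "\<dots> = ?p \<leadsto> ?p" using resid_resid[OF p assms one_closed] by simp
  finally show ?thesis using resid_self[OF p] by simp
qed

lemma mult_le: "\<lbrakk>x \<in> carrier A; y \<in> carrier A\<rbrakk> \<Longrightarrow> (x \<otimes> y) \<leadsto> y = \<one>"
  by (simp flip: resid_resid add: resid_self resid_one)

lemma mult_resid_eq:
  assumes "x \<in> carrier A" "y \<in> carrier A" "x \<preceq> y" shows "x = y \<otimes> (y \<leadsto> x)"
  using divisibility[OF assms(1,2)] assms by (simp add: hoop_le_def)

text \<open>Monotonicity comes from multiplicativity: a \<le> b makes b a factor of a, hence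
  \<open>\<delta> b\<close> a factor of \<open>\<delta> a\<close>. The conditions left besides
  closure are equations, so they pass to generated varieties.\<close>

lemma multiplicative_conucleusI:
  assumes "\<And>a. a \<in> carrier A \<Longrightarrow> \<delta> a \<in> carrier A"
    and "\<And>a. a \<in> carrier A \<Longrightarrow> \<delta> a \<leadsto> a = \<one>"
    and "\<And>a. a \<in> carrier A \<Longrightarrow> \<delta> (\<delta> a) = \<delta> a"
    and mult: "\<And>a b. \<lbrakk>a \<in> carrier A; b \<in> carrier A\<rbrakk> \<Longrightarrow> \<delta> (a \<otimes> b) = \<delta> a \<otimes> \<delta> b"
  shows "multiplicative_conucleus A \<delta>"
proof (unfold_locales)
  fix a b assume ab: "a \<in> carrier A" "b \<in> carrier A" "a \<preceq> b"
  have "\<delta> a = \<delta> b \<otimes> \<delta> (b \<leadsto> a)"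
    using mult_resid_eq[OF ab] mult[of b "b \<leadsto> a"] ab by simp
  then show "\<delta> a \<preceq> \<delta> b"
    using mult_le[of "\<delta> (b \<leadsto> a)" "\<delta> b"] ab assms(1) by (simp add: hoop_le_def m_comm)
qed (use assms in \<open>auto simp: hoop_le_def\<close>)

lemma multiplicative_conucleus_id:
  "(\<And>a. a \<in> carrier A \<Longrightarrow> \<delta> a = a) \<Longrightarrow> multiplicative_conucleus A \<delta>"
  by (rule multiplicative_conucleusI) (simp_all add: resid_self)

end

section \<open>Terms and varieties\<close>

lemma eval_closed: "\<lbrakk>algebra A; range v \<subseteq> carrier A\<rbrakk> \<Longrightarrow> eval A v t \<in> carrier A"
  by (induction t) (auto simp: algebra_def)

lemma hoop_algebra: "hoop A \<Longrightarrow> algebra A"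
  by (simp add: algebra_def hoop.resid_closed hoop_def comm_monoid_def monoid.m_closed monoid.one_closed)

lemma term_fun_simps [simp]:
  "term_fun A X a = a"
  "term_fun A Top a = \<one>\<^bsub>A\<^esub>"
  "term_fun A (s \<^bold>\<cdot> t) a = term_fun A s a \<otimes>\<^bsub>A\<^esub> term_fun A t a"
  "term_fun A (s \<^bold>\<rightarrow> t) a = term_fun A s a \<leadsto>\<^bsub>A\<^esub> term_fun A t a"
  by (simp_all add: term_fun_def)

lemma term_fun_closed: "\<lbrakk>algebra A; a \<in> carrier A\<rbrakk> \<Longrightarrow> term_fun A t a \<in> carrier A"
  by (simp add: term_fun_def eval_closed)

lemma satisfies_unary_iff:
  "A \<Turnstile> s \<approx> t \<longleftrightarrow> (\<forall>a \<in> carrier A. term_fun A s a = term_fun A t a)"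
proof
  assume "A \<Turnstile> s \<approx> t"
  then show "\<forall>a \<in> carrier A. term_fun A s a = term_fun A t a"
    by (auto simp: satisfies_def term_fun_def)
next
  assume eq: "\<forall>a \<in> carrier A. term_fun A s a = term_fun A t a"
  have "eval A v s = eval A v t" if "range v \<subseteq> carrier A" for v
  proof -
    have v: "(\<lambda>_. v ()) = v" by (simp add: fun_eq_iff)
    have "v () \<in> carrier A" using that by blast
    then have "eval A (\<lambda>_. v ()) s = eval A (\<lambda>_. v ()) t" using eq unfolding term_fun_def by blast
    then show ?thesis unfolding v .
  qed
  then show "A \<Turnstile> s \<approx> t" by (simp add: satisfies_def)
qed

lemma term_fun_tpow: "term_fun A (tpow t n) a = term_fun A t a [^]\<^bsub>A\<^esub> n"
  by (induction n) (simp_all add: nat_pow_def)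

text \<open>Equations of varieties use variables from \<open>nat\<close>, whereas \<open>t\<close>
  is unary. Substitution lets them speak about \<open>t\<close> at compound arguments such as
  products.\<close>

primrec subst :: "'v hterm \<Rightarrow> unary_hterm \<Rightarrow> 'v hterm" where
  "subst s (Var u) = s"
| "subst s Top = Top"
| "subst s (t \<^bold>\<cdot> u) = subst s t \<^bold>\<cdot> subst s u"
| "subst s (t \<^bold>\<rightarrow> u) = subst s t \<^bold>\<rightarrow> subst s u"

lemma eval_subst [simp]: "eval A v (subst s t) = term_fun A t (eval A v s)"
  by (induction t) (simp_all add: term_fun_def)

text \<open>The hoop axioms are listed too, because membership in a variety yields only closure
  under the operations and the equations of the generators. Monotonicity, an implication, is
  recovered through divisibility.\<close>

definition conucleus_equations :: "unary_hterm \<Rightarrow> (nat hterm \<times> nat hterm) set" where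
  "conucleus_equations t = (let x = Var 0; y = Var 1; z = Var 2 in
    {((x \<^bold>\<cdot> y) \<^bold>\<cdot> z, x \<^bold>\<cdot> (y \<^bold>\<cdot> z)), (x \<^bold>\<cdot> y, y \<^bold>\<cdot> x), (Top \<^bold>\<cdot> x, x),
     (x \<^bold>\<rightarrow> x, Top), (x \<^bold>\<cdot> (x \<^bold>\<rightarrow> y), y \<^bold>\<cdot> (y \<^bold>\<rightarrow> x)),
     (x \<^bold>\<rightarrow> (y \<^bold>\<rightarrow> z), (x \<^bold>\<cdot> y) \<^bold>\<rightarrow> z),
     (subst x t \<^bold>\<rightarrow> x, Top), (subst (subst x t) t, subst x t),
     (subst (x \<^bold>\<cdot> y) t, subst x t \<^bold>\<cdot> subst y t)})"

lemma models_conucleus_equations: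
  assumes "multiplicative_conucleus A (term_fun A t)"
  shows "models A (conucleus_equations t)"
proof -
  interpret multiplicative_conucleus A "term_fun A t" by fact
  have "v i \<in> carrier A" if "range v \<subseteq> carrier A" for v :: "nat \<Rightarrow> 'a" and i
    using that by blast
  then show ?thesis
    using contracting unfolding hoop_le_def
    by (auto simp: models_def conucleus_equations_def Let_def satisfies_def m_assoc resid_self
        divisibility resid_resid idempotent multiplicative intro: m_comm)
qed

lemma conucleus_if_models:
  assumes A: "algebra A" and E: "models A (conucleus_equations t)"
  shows "multiplicative_conucleus A (term_fun A t)"
proof -
  have eq: "eval A (case_nat a (case_nat b (\<lambda>_. c))) s = eval A (case_nat a (case_nat b (\<lambda>_. c))) s'"
    if "(s, s') \<in> conucleus_equations t" "a \<in> carrier A" "b \<in> carrier A" "c \<in> carrier A" for s s' a b c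
  proof -
    have "range (case_nat a (case_nat b (\<lambda>_. c))) \<subseteq> carrier A"
      using that by (auto split: nat.splits)
    then show ?thesis using E that(1) by (auto simp: models_def satisfies_def)
  qed
  have two: "(2::nat) = Suc (Suc 0)" by simp
  interpret hoop A
  proof unfold_locales
    fix x y z assume xyz: "x \<in> carrier A" "y \<in> carrier A" "z \<in> carrier A"
    show "x \<otimes>\<^bsub>A\<^esub> y \<otimes>\<^bsub>A\<^esub> z = x \<otimes>\<^bsub>A\<^esub> (y \<otimes>\<^bsub>A\<^esub> z)"
      using eq[of "(Var 0 \<^bold>\<cdot> Var 1) \<^bold>\<cdot> Var 2" "Var 0 \<^bold>\<cdot> (Var 1 \<^bold>\<cdot> Var 2)" x y z] xyz
      by (simp add: conucleus_equations_def Let_def two)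
    show "x \<leadsto>\<^bsub>A\<^esub> (y \<leadsto>\<^bsub>A\<^esub> z) = (x \<otimes>\<^bsub>A\<^esub> y) \<leadsto>\<^bsub>A\<^esub> z"
      using eq[of "Var 0 \<^bold>\<rightarrow> (Var 1 \<^bold>\<rightarrow> Var 2)" "(Var 0 \<^bold>\<cdot> Var 1) \<^bold>\<rightarrow> Var 2" x y z] xyz
      by (simp add: conucleus_equations_def Let_def two)
  next
    fix x y assume xy: "x \<in> carrier A" "y \<in> carrier A"
    show "x \<otimes>\<^bsub>A\<^esub> y = y \<otimes>\<^bsub>A\<^esub> x"
      using eq[of "Var 0 \<^bold>\<cdot> Var 1" "Var 1 \<^bold>\<cdot> Var 0" x y y] xy
      by (simp add: conucleus_equations_def Let_def)
    show "x \<otimes>\<^bsub>A\<^esub> (x \<leadsto>\<^bsub>A\<^esub> y) = y \<otimes>\<^bsub>A\<^esub> (y \<leadsto>\<^bsub>A\<^esub> x)"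
      using eq[of "Var 0 \<^bold>\<cdot> (Var 0 \<^bold>\<rightarrow> Var 1)" "Var 1 \<^bold>\<cdot> (Var 1 \<^bold>\<rightarrow> Var 0)" x y y] xy
      by (simp add: conucleus_equations_def Let_def)
  next
    fix x assume x: "x \<in> carrier A"
    show *: "\<one>\<^bsub>A\<^esub> \<otimes>\<^bsub>A\<^esub> x = x"
      using eq[of "Top \<^bold>\<cdot> Var 0" "Var 0" x x x] x by (simp add: conucleus_equations_def Let_def)
    show "x \<leadsto>\<^bsub>A\<^esub> x = \<one>\<^bsub>A\<^esub>"
      using eq[of "Var 0 \<^bold>\<rightarrow> Var 0" "Top" x x x] x by (simp add: conucleus_equations_def Let_def)
    show "x \<otimes>\<^bsub>A\<^esub> \<one>\<^bsub>A\<^esub> = x"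
      using eq[of "Var 0 \<^bold>\<cdot> Var 1" "Var 1 \<^bold>\<cdot> Var 0" x "\<one>\<^bsub>A\<^esub>" x] x A *
      by (simp add: conucleus_equations_def Let_def algebra_def)
  qed (use A in \<open>auto simp: algebra_def\<close>)
  show ?thesis
  proof (rule multiplicative_conucleusI)
    fix x y assume xy: "x \<in> carrier A" "y \<in> carrier A"
    show "term_fun A t (x \<otimes>\<^bsub>A\<^esub> y) = term_fun A t x \<otimes>\<^bsub>A\<^esub> term_fun A t y"
      using eq[of "subst (Var 0 \<^bold>\<cdot> Var 1) t" "subst (Var 0) t \<^bold>\<cdot> subst (Var 1) t" x y y] xy
      by (simp add: conucleus_equations_def Let_def)
  next
    fix x assume x: "x \<in> carrier A"
    show "term_fun A t x \<leadsto>\<^bsub>A\<^esub> x = \<one>\<^bsub>A\<^esub>"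
      using eq[of "subst (Var 0) t \<^bold>\<rightarrow> Var 0" "Top" x x x] x by (simp add: conucleus_equations_def Let_def)
    show "term_fun A t (term_fun A t x) = term_fun A t x"
      using eq[of "subst (subst (Var 0) t) t" "subst (Var 0) t" x x x] x
      by (simp add: conucleus_equations_def Let_def)
    show "term_fun A t x \<in> carrier A" using A x by (rule term_fun_closed)
  qed
qed

lemma variety_conucleus:
  assumes "A \<in> \<V> I J K"
    and "\<And>i. i \<in> I \<Longrightarrow> multiplicative_conucleus (S i) (term_fun (S i) t)"
    and "\<And>j. j \<in> J \<Longrightarrow> multiplicative_conucleus (S_lex j) (term_fun (S_lex j) t)"
    and "K = {0} \<Longrightarrow> multiplicative_conucleus S\<^sup>\<omega> (term_fun S\<^sup>\<omega> t)"
  shows "multiplicative_conucleus A (term_fun A t)"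
proof -
  have "generators_model I J K (conucleus_equations t)"
    using assms(2-) by (simp add: generators_model_def models_conucleus_equations)
  then show ?thesis
    using assms(1) by (auto simp: variety_def intro: conucleus_if_models)
qed

section \<open>The generators\<close>

lemma S_cancel_simps [simp]:
  "carrier S\<^sup>\<omega> = UNIV" "x \<otimes>\<^bsub>S\<^sup>\<omega>\<^esub> y = x + y" "\<one>\<^bsub>S\<^sup>\<omega>\<^esub> = 0" "x \<leadsto>\<^bsub>S\<^sup>\<omega>\<^esub> y = y - x"
  by (simp_all add: S_cancel_def)

lemma hoop_S_cancel: "hoop S\<^sup>\<omega>"
  by unfold_locales (auto simp: Units_def)

section \<open>Unit intervals of ordered abelian groups\<close>

instance prod :: (linordered_ab_group_add, linordered_ab_group_add) linordered_ab_group_add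
  by standard (auto simp: less_eq_prod_def)

lemma unit_interval_hoop_identities:
  fixes x y z u :: "'g :: linordered_ab_group_add"
  assumes "0 \<le> x" "x \<le> u" "0 \<le> y" "y \<le> u" "0 \<le> z" "z \<le> u"
  shows "max (max (x + y - u) 0 + z - u) 0 = max (x + max (y + z - u) 0 - u) 0" (is ?A)
    and "min (u - x + min (u - y + z) u) u = min (u - max (x + y - u) 0 + z) u" (is ?B)
    and "max (x + min (u - x + y) u - u) 0 = min x y" (is ?C)
proof -
  have "max (x + y - u) 0 + z - u = max (x + y - u + z - u) (0 + z - u)"
    by (simp only: max_add_distrib_left max_diff_distrib_left)
  moreover have "x + max (y + z - u) 0 - u = max (x + (y + z - u) - u) (x + 0 - u)"
    by (simp only: max_add_distrib_right max_diff_distrib_left)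
  ultimately show ?A using assms by (simp add: max.assoc max_absorb2 algebra_simps)
  have 1: "u - x + min (u - y + z) u = min (u - x + (u - y + z)) (u - x + u)"
    by (simp only: min_add_distrib_right)
  have 2: "u - max (x + y - u) 0 + z = min (u - (x + y - u) + z) (u - 0 + z)"
    by (auto simp: min_def max_def algebra_simps)
  have 3: "min (u - x + u) u = u" "min (u - 0 + z) u = u"
    using assms by (auto intro!: min_absorb2 simp: algebra_simps)
  show ?B unfolding 1 2 min.assoc 3 by (simp add: algebra_simps)
  have "x + min (u - x + y) u - u = min (x + (u - x + y) - u) (x + u - u)"
    by (simp only: min_add_distrib_right min_diff_distrib_left)
  then have "x + min (u - x + y) u - u = min x y" by (simp add: min.commute)
  then show ?C using assms by (simp add: max_absorb1)
qed

lemma reflect_truncated_sum: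
  "u - min (u - x + (u - y)) u = max (x + y - u) (0 :: 'g :: linordered_ab_group_add)"
proof -
  have "u - min (u - w) u = max w 0" for w
    by (auto simp: min_def max_def)
  moreover have "u - x + (u - y) = u - (x + y - u)" by (simp add: algebra_simps)
  ultimately show ?thesis by metis
qed

lemma S_lex_simps:
  "carrier (S_lex n) = {0..(int n, 0)}"
  "\<one>\<^bsub>S_lex n\<^esub> = (int n, 0)"
  "x \<otimes>\<^bsub>S_lex n\<^esub> y = max (x + y - (int n, 0)) 0"
  "x \<leadsto>\<^bsub>S_lex n\<^esub> y = min ((int n, 0) - x + y) (int n, 0)"
  by (simp_all only: S_lex_def lplus_def lneg_def reflect_truncated_sum zero_prod_def
      hoop_alg.simps monoid.simps partial_object.simps)

lemma S_lex_unit_nonneg [simp]: "0 \<le> (int n, 0 :: int)"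
  by (simp add: zero_prod_def)

lemma hoop_S_lex: "hoop (S_lex n)"
proof -
  define u where "u = (int n, 0 :: int)"
  have u: "0 \<le> u" by (simp add: u_def zero_prod_def)
  note [simp] = S_lex_simps[of n, folded u_def]
  show ?thesis
  proof unfold_locales
    fix x y z assume "x \<in> carrier (S_lex n)" "y \<in> carrier (S_lex n)" "z \<in> carrier (S_lex n)"
    then have *: "0 \<le> x" "x \<le> u" "0 \<le> y" "y \<le> u" "0 \<le> z" "z \<le> u" by simp_all
    show "x \<otimes>\<^bsub>S_lex n\<^esub> y \<otimes>\<^bsub>S_lex n\<^esub> z = x \<otimes>\<^bsub>S_lex n\<^esub> (y \<otimes>\<^bsub>S_lex n\<^esub> z)"
      using unit_interval_hoop_identities(1)[OF *] by simp
    show "x \<leadsto>\<^bsub>S_lex n\<^esub> y \<leadsto>\<^bsub>S_lex n\<^esub> z = x \<otimes>\<^bsub>S_lex n\<^esub> y \<leadsto>\<^bsub>S_lex n\<^esub> z"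
      using unit_interval_hoop_identities(2)[OF *] by simp
  next
    fix x y assume "x \<in> carrier (S_lex n)" "y \<in> carrier (S_lex n)"
    then have *: "0 \<le> x" "x \<le> u" "0 \<le> y" "y \<le> u" by simp_all
    show "x \<otimes>\<^bsub>S_lex n\<^esub> y = y \<otimes>\<^bsub>S_lex n\<^esub> x" by (simp add: add.commute)
    have "x + y - u \<le> u"
      using add_mono[OF *(2) *(4)] by (simp add: algebra_simps)
    then show "x \<otimes>\<^bsub>S_lex n\<^esub> y \<in> carrier (S_lex n)" using u by simp
    have "0 \<le> u - x + y" using * by (simp add: add_increasing2)
    then show "x \<leadsto>\<^bsub>S_lex n\<^esub> y \<in> carrier (S_lex n)" using u by simp
    show "x \<otimes>\<^bsub>S_lex n\<^esub> (x \<leadsto>\<^bsub>S_lex n\<^esub> y) = y \<otimes>\<^bsub>S_lex n\<^esub> (y \<leadsto>\<^bsub>S_lex n\<^esub> x)"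
      using unit_interval_hoop_identities(3)[OF * *(1,2)]
        unit_interval_hoop_identities(3)[OF *(3,4) *(1,2) *(1,2)] by (simp add: min.commute)
  qed (use u in \<open>auto simp: add.commute max_absorb1\<close>)
qed

interpretation S_lex: hoop "S_lex n" for n
  by (rule hoop_S_lex)

section \<open>First components, powers and the radical\<close>

lemma fst_S_lex:
  "fst (x \<otimes>\<^bsub>S_lex n\<^esub> y) = max (fst x + fst y - int n) 0"
  "fst (x \<leadsto>\<^bsub>S_lex n\<^esub> y) = min (int n - fst x + fst y) (int n)"
  "fst \<one>\<^bsub>S_lex n\<^esub> = int n"
  by (auto simp: S_lex_simps max_def min_def less_eq_prod_def)

lemma S_lex_carrierD:
  assumes "x \<in> carrier (S_lex n)" shows "0 \<le> fst x" "fst x \<le> int n"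
  using assms by (auto simp: S_lex_simps less_eq_prod_def)

lemma S_lex_mult_eq_0: "fst x + fst y < int n \<Longrightarrow> x \<otimes>\<^bsub>S_lex n\<^esub> y = 0"
  by (auto simp: S_lex_simps max_def less_eq_prod_def)

lemma S_lex_zero:
  "0 \<in> carrier (S_lex n)" "x \<in> carrier (S_lex n) \<Longrightarrow> 0 \<leadsto>\<^bsub>S_lex n\<^esub> x = \<one>\<^bsub>S_lex n\<^esub>"
  "x \<in> carrier (S_lex n) \<Longrightarrow> x \<otimes>\<^bsub>S_lex n\<^esub> 0 = 0" "x \<in> carrier (S_lex n) \<Longrightarrow> 0 \<otimes>\<^bsub>S_lex n\<^esub> x = 0"
  by (auto simp: S_lex_simps min_def max_def)

text \<open>Each further factor lowers the first component by at least 1 or truncates the product to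
  0.\<close>

lemma S_lex_pow_bound:
  assumes "x \<in> carrier (S_lex n)" "fst x < int n"
  shows "x [^]\<^bsub>S_lex n\<^esub> k = 0 \<or> fst (x [^]\<^bsub>S_lex n\<^esub> k) \<le> int n - int k"
proof (induction k)
  case (Suc k)
  let ?y = "x [^]\<^bsub>S_lex n\<^esub> k"
  show ?case
  proof (cases "?y = 0 \<or> fst ?y + fst x < int n")
    case True
    then show ?thesis using assms S_lex_mult_eq_0[of ?y x n] by (auto simp: S_lex_zero)
  next
    case False
    then show ?thesis using Suc assms by (auto simp: fst_S_lex)
  qed
qed (simp add: fst_S_lex)

text \<open>The exponent has to exceed \<open>n\<close>: for n, b > 0 the n-th power of (n - 1, b)
  is (0, n b), still nonzero.\<close>

lemma S_lex_pow_eq_0: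
  assumes "x \<in> carrier (S_lex n)" "fst x < int n" "n < k"
  shows "x [^]\<^bsub>S_lex n\<^esub> k = 0"
  using S_lex_pow_bound[OF assms(1,2), of k] assms S_lex_carrierD(1)[of "x [^]\<^bsub>S_lex n\<^esub> k" n]
  by auto

lemma fst_S_lex_pow_radical: "fst x = int n \<Longrightarrow> fst (x [^]\<^bsub>S_lex n\<^esub> (k::nat)) = int n"
  by (induction k) (auto simp: fst_S_lex)

text \<open>Elements of first component \<open>n\<close> are the pairs (n, -b) with b \<ge> 0, and
  their products escape truncation. They multiply like the naturals b under addition, and the
  identity is cancellation of \<open>z\<close>.\<close>

lemma S_lex_radical_resid:
  assumes "z \<in> carrier (S_lex n)" "fst z = int n" "0 < n"
  shows "z \<leadsto>\<^bsub>S_lex n\<^esub> z \<otimes>\<^bsub>S_lex n\<^esub> z = z"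
  using assms by (cases z) (auto simp: S_lex_simps min_def max_def zero_prod_def)

text \<open>The operation computed by the term prescribed for \<open>J\<^sub>2\<close>.\<close>

definition radical_part :: "nat \<Rightarrow> int \<times> int \<Rightarrow> int \<times> int" where
  "radical_part n a = (if fst a = int n then a else 0)"

text \<open>The radical is a filter: first components are at most \<open>n\<close>, so a product
  reaches \<open>n\<close> only if both factors do.\<close>

lemma multiplicative_conucleus_radical_part:
  assumes "\<And>a. a \<in> carrier (S_lex n) \<Longrightarrow> \<delta> a = radical_part n a"
  shows "multiplicative_conucleus (S_lex n) \<delta>"
proof (rule S_lex.multiplicative_conucleusI)
  have zero: "0 \<otimes>\<^bsub>S_lex n\<^esub> a = 0" "a \<otimes>\<^bsub>S_lex n\<^esub> 0 = 0" if "a \<in> carrier (S_lex n)" for a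
    using that by (auto simp: S_lex_zero)
  fix a b assume ab: "a \<in> carrier (S_lex n)" "b \<in> carrier (S_lex n)"
  have "radical_part n (a \<otimes>\<^bsub>S_lex n\<^esub> b) = radical_part n a \<otimes>\<^bsub>S_lex n\<^esub> radical_part n b"
    using ab S_lex_carrierD[OF ab(1)] S_lex_carrierD[OF ab(2)] S_lex_zero(1)[of n]
    by (auto simp: radical_part_def fst_S_lex zero max_def split: if_splits)
  then show "\<delta> (a \<otimes>\<^bsub>S_lex n\<^esub> b) = \<delta> a \<otimes>\<^bsub>S_lex n\<^esub> \<delta> b"
    using ab assms by simp
qed (use assms in \<open>auto simp: radical_part_def S_lex.resid_self S_lex_zero\<close>)

text \<open>On the radical, with z the power of exponent j + 1, cancellation makes the factor of
  \<open>X\<close> equal to z \<rightarrow> z = \<top>. Off it both powers vanish and the factor is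
  (0 \<rightarrow> 0) \<rightarrow> 0 = 0.\<close>

lemma term_fun_radical_part:
  assumes a: "a \<in> carrier (S_lex j)" and j: "0 < j"
  shows "term_fun (S_lex j)
      (X \<^bold>\<cdot> ((tpow X (j + 1) \<^bold>\<rightarrow> tpow X (2 * (j + 1))) \<^bold>\<rightarrow> tpow X (j + 1))) a = radical_part j a"
proof (cases "fst a = int j")
  case True
  define z where "z = a [^]\<^bsub>S_lex j\<^esub> (j + 1)"
  have z: "z \<in> carrier (S_lex j)" "fst z = int j"
    unfolding z_def using a fst_S_lex_pow_radical[OF True] by (blast intro: S_lex.nat_pow_closed, blast)
  have "a [^]\<^bsub>S_lex j\<^esub> (2 * (j + 1)) = z \<otimes>\<^bsub>S_lex j\<^esub> z"
    unfolding z_def using a by (simp only: S_lex.nat_pow_mult mult_2)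
  then show ?thesis
    using True a z S_lex_radical_resid[OF z j]
    by (simp only: term_fun_simps term_fun_tpow flip: z_def)
      (simp add: S_lex.resid_self radical_part_def)
next
  case False
  then have "fst a < int j" using S_lex_carrierD(2)[OF a] by simp
  then have "a [^]\<^bsub>S_lex j\<^esub> (j + 1) = 0" "a [^]\<^bsub>S_lex j\<^esub> (2 * (j + 1)) = 0"
    by (intro S_lex_pow_eq_0 a; simp)+
  then show ?thesis
    using False a
    by (simp only: term_fun_simps term_fun_tpow)
      (simp add: S_lex_zero radical_part_def S_lex.one_resid)
qed

text \<open>\<open>S n\<close> is the subalgebra \<open>{(k, 0) | k. k \<le> n}\<close> of \<open>S_lex n\<close>, scaled by \<open>1/n\<close>.\<close>

lemma S_simps:
  "carrier (S n) = {real k / real n | k. k \<le> n}" "\<one>\<^bsub>S n\<^esub> = 1"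
  "x \<otimes>\<^bsub>S n\<^esub> y = max (x + y - 1) 0" "x \<leadsto>\<^bsub>S n\<^esub> y = min (y - x + 1) 1"
  by (simp_all add: S_def)

lemma eval_S:
  assumes n: "0 < n" and v: "\<And>i. k i \<le> n \<and> v i = real (k i) / real n"
  shows "\<exists>m\<le>n. eval (S n) v t = real m / real n \<and>
    eval (S_lex n) (\<lambda>i. (int (k i), 0)) t = (int m, 0)"
proof (induction t)
  case (Var i)
  then show ?case using v[of i] by (intro exI[of _ "k i"]) simp
next
  case Top
  then show ?case using n by (intro exI[of _ n]) (simp add: S_simps S_lex_simps)
next
  case (Mult s t)
  then obtain p q where "p \<le> n" "q \<le> n"
    "eval (S n) v s = real p / real n" "eval (S_lex n) (\<lambda>i. (int (k i), 0)) s = (int p, 0)"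
    "eval (S n) v t = real q / real n" "eval (S_lex n) (\<lambda>i. (int (k i), 0)) t = (int q, 0)"
    by blast
  moreover have "max (real p / real n + real q / real n - 1) 0 = real (p + q - n) / real n"
    using n by (cases "n \<le> p + q") (auto simp: of_nat_diff max_def field_simps)
  moreover have "max ((int p, 0) + (int q, 0) - (int n, 0)) 0 = (int (p + q - n), 0 :: int)"
    by (auto simp: max_def zero_prod_def)
  ultimately show ?case by (intro exI[of _ "p + q - n"]) (simp add: S_simps S_lex_simps)
next
  case (Imp s t)
  then obtain p q where "p \<le> n" "q \<le> n"
    "eval (S n) v s = real p / real n" "eval (S_lex n) (\<lambda>i. (int (k i), 0)) s = (int p, 0)"
    "eval (S n) v t = real q / real n" "eval (S_lex n) (\<lambda>i. (int (k i), 0)) t = (int q, 0)"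
    by blast
  moreover have "min (real q / real n - real p / real n + 1) 1 = real (min (n + q - p) n) / real n"
    using n \<open>p \<le> n\<close> by (auto simp: of_nat_diff min_def field_simps)
  moreover have "min ((int n, 0) - (int p, 0) + (int q, 0)) (int n, 0) = (int (min (n + q - p) n), 0 :: int)"
    using \<open>p \<le> n\<close> by (auto simp: min_def)
  ultimately show ?case by (intro exI[of _ "min (n + q - p) n"]) (simp add: S_simps S_lex_simps)
qed

lemma term_fun_S:
  assumes "0 < n" "k \<le> n"
  obtains m where "m \<le> n" "term_fun (S n) t (real k / real n) = real m / real n"
    "term_fun (S_lex n) t (int k, 0) = (int m, 0)"
  using eval_S[of n "\<lambda>_. k" "\<lambda>_. real k / real n" t] assms unfolding term_fun_def by auto

lemma S_point_in_S_lex: "k \<le> n \<Longrightarrow> (int k, 0) \<in> carrier (S_lex n)"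
  by (auto simp: S_lex_simps zero_prod_def)

lemma satisfies_S:
  fixes s t :: "'v hterm"
  assumes n: "0 < n" and st: "S_lex n \<Turnstile> s \<approx> t"
  shows "S n \<Turnstile> s \<approx> t"
  unfolding satisfies_def
proof (intro allI impI)
  fix v :: "'v \<Rightarrow> real" assume "range v \<subseteq> carrier (S n)"
  then have "\<forall>i. \<exists>k. k \<le> n \<and> v i = real k / real n" by (fastforce simp: S_simps)
  then obtain k where k: "\<And>i. k i \<le> n \<and> v i = real (k i) / real n" by metis
  have "range (\<lambda>i. (int (k i), 0)) \<subseteq> carrier (S_lex n)" using k by (auto intro: S_point_in_S_lex)
  then have eq: "eval (S_lex n) (\<lambda>i. (int (k i), 0)) s = eval (S_lex n) (\<lambda>i. (int (k i), 0)) t"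
    using st unfolding satisfies_def by blast
  have "\<exists>m\<le>n. eval (S n) v r = real m / real n \<and> eval (S_lex n) (\<lambda>i. (int (k i), 0)) r = (int m, 0)" for r
    using n k by (rule eval_S)
  from this[of s] this[of t] show "eval (S n) v s = eval (S n) v t" using eq by auto
qed

text \<open>Only the points (k, 0) are compared, since identities needed for \<open>S n\<close> may
  fail elsewhere in \<open>S_lex n\<close>: for n \<ge> 2 the n-th power moves every radical element
  except \<top>, while the separation term fixes them.\<close>

lemma S_unary_satisfies:
  assumes n: "0 < n"
    and eq: "\<And>k. k \<le> n \<Longrightarrow> term_fun (S_lex n) s (int k, 0) = term_fun (S_lex n) t (int k, 0)"
  shows "S n \<Turnstile> s \<approx> t"
  unfolding satisfies_unary_iff
proof
  fix a assume "a \<in> carrier (S n)"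
  then obtain k where k: "k \<le> n" "a = real k / real n" by (auto simp: S_simps)
  show "term_fun (S n) s a = term_fun (S n) t a"
    using term_fun_S[OF n k(1), of s] term_fun_S[OF n k(1), of t] eq[OF k(1)] k(2)
    by (metis of_nat_eq_iff prod.inject)
qed

lemma hoop_S: assumes "0 < n" shows "hoop (S n)"
proof -
  \<comment> \<open>The identity map is a conucleus, so the hoop laws reach \<open>S n\<close> as
    part of \<open>conucleus_equations X\<close>.\<close>
  have "multiplicative_conucleus (S_lex n) (term_fun (S_lex n) X)"
    by (rule S_lex.multiplicative_conucleus_id) simp
  then have "models (S n) (conucleus_equations X)"
    using models_conucleus_equations satisfies_S[OF assms] by (fastforce simp: models_def)
  moreover have "algebra (S n)"
  proof -
    have "x \<otimes>\<^bsub>S n\<^esub> y \<in> carrier (S n) \<and> x \<leadsto>\<^bsub>S n\<^esub> y \<in> carrier (S n)"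
      if xy: "x \<in> carrier (S n)" "y \<in> carrier (S n)" for x y
    proof -
      obtain p q where pq: "p \<le> n" "x = real p / real n" "q \<le> n" "y = real q / real n"
        using xy unfolding S_simps(1) by blast
      have "\<exists>m\<le>n. eval (S n) (\<lambda>b. if b then x else y) t = real m / real n \<and>
          eval (S_lex n) (\<lambda>b. (int (if b then p else q), 0)) t = (int m, 0)" for t
        using assms by (rule eval_S) (use pq in auto)
      from this[of "Var True \<^bold>\<cdot> Var False"] this[of "Var True \<^bold>\<rightarrow> Var False"]
      show ?thesis by (auto simp: S_simps(1))
    qed
    moreover have "1 \<in> carrier (S n)" using assms by (force simp: S_simps)
    ultimately show ?thesis by (simp add: algebra_def S_simps(2))
  qed
  ultimately show ?thesis
    using conucleus_if_models multiplicative_conucleus.axioms(1) by blast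
qed

text \<open>Exponent \<open>n\<close> is enough here: the bound on powers forces first component 0,
  and the second component stays 0 because the points (k, 0) form a subalgebra.\<close>

lemma S_lex_point_pow:
  assumes "0 < n" "k < n"
  shows "term_fun (S_lex n) (tpow X n) (int k, 0) = 0"
proof -
  obtain m where m: "term_fun (S_lex n) (tpow X n) (int k, 0) = (int m, 0)"
    using term_fun_S[of n k "tpow X n"] assms by auto
  then show ?thesis
    using S_lex_pow_bound[of "(int k, 0)" n n] assms S_point_in_S_lex[of k n]
    by (auto simp: term_fun_tpow zero_prod_def)
qed

lemma S_pow:
  assumes n: "0 < n" and a: "a \<in> carrier (S n)"
  shows "term_fun (S n) (tpow X n) a = (if a = 1 then 1 else 0)"
proof -
  interpret hoop "S n" using n by (rule hoop_S)
  obtain k where k: "k \<le> n" "a = real k / real n" using a by (auto simp: S_simps)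
  show ?thesis
  proof (cases "k = n")
    case True
    then have "a = 1" using k n by simp
    then show ?thesis using nat_pow_one[of n] by (simp add: term_fun_tpow S_simps)
  next
    case False
    then have "a \<noteq> 1" "k < n" using k n by simp_all
    then show ?thesis
      using term_fun_S[OF n k(1), of "tpow X n"] S_lex_point_pow[OF n] k
      by (metis div_0 fst_conv fst_zero of_nat_0 of_nat_eq_0_iff)
  qed
qed

text \<open>A product in [0, 1] is 1 exactly when both factors are, so the indicator of 1 is
  multiplicative.\<close>

lemma multiplicative_conucleus_S_pow:
  assumes n: "0 < n" and \<delta>: "\<And>a. a \<in> carrier (S n) \<Longrightarrow> \<delta> a = (if a = 1 then 1 else 0)"
  shows "multiplicative_conucleus (S n) \<delta>"
proof -
  interpret hoop "S n" using n by (rule hoop_S)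
  have zo: "0 \<in> carrier (S n)" "1 \<in> carrier (S n)" using n by (force simp: S_simps)+
  have bnd: "0 \<le> a \<and> a \<le> 1" if "a \<in> carrier (S n)" for a
    using that n by (auto simp: S_simps)
  show ?thesis
  proof (rule multiplicative_conucleusI)
    fix a b assume "a \<in> carrier (S n)" "b \<in> carrier (S n)"
    then show "\<delta> (a \<otimes>\<^bsub>S n\<^esub> b) = \<delta> a \<otimes>\<^bsub>S n\<^esub> \<delta> b"
      using \<delta> bnd[of a] bnd[of b] m_closed[of a b] by (auto simp: S_simps(3) max_def)
  next
    fix a assume a: "a \<in> carrier (S n)"
    show "\<delta> a \<leadsto>\<^bsub>S n\<^esub> a = \<one>\<^bsub>S n\<^esub>" using \<delta>[OF a] bnd[OF a] by (auto simp: S_simps)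
  qed (use \<delta> zo in auto)
qed

section \<open>The separation term\<close>

text \<open>
  Off the radical \<open>{a. fst a = n}\<close> of \<open>S_lex n\<close>, the power \<open>x\<^sup>N\<close> is the missing constant
  \<open>0\<close> as soon as \<open>N > n\<close>. With this constant, \<open>x \<mapsto> (u \<rightarrow> x) \<rightarrow> ((x \<rightarrow> u) \<cdot> \<not> (x \<rightarrow> u)\<^sup>N)\<close>
  subtracts \<open>x\<close> from \<open>u\<close> modulo \<open>n\<close>.
\<close>

primrec residue_term :: "nat \<Rightarrow> nat \<Rightarrow> unary_hterm" where
  "residue_term N 0 = tpow X N"
| "residue_term N (Suc m) = (residue_term N m \<^bold>\<rightarrow> X) \<^bold>\<rightarrow>
     ((X \<^bold>\<rightarrow> residue_term N m) \<^bold>\<cdot> (tpow (X \<^bold>\<rightarrow> residue_term N m) N \<^bold>\<rightarrow> tpow X N))"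

text \<open>
  For \<open>c > 0\<close> the antecedent is infinitesimal at infinitesimal \<open>x\<close>, and it is \<open>\<top>\<close> elsewhere off
  the radical. So the parameter \<open>c\<close> decides whether the elements close to \<open>0\<close> pass the test.
\<close>

definition test_term :: "nat \<Rightarrow> nat \<Rightarrow> nat \<Rightarrow> unary_hterm" where
  "test_term N c m =
     tpow (tpow (X \<^bold>\<rightarrow> tpow X N) N \<^bold>\<rightarrow> tpow X N) c \<^bold>\<rightarrow> residue_term N m"

text \<open>On the radical and on \<open>S\<^sup>\<omega>\<close>, \<open>z = x\<^sup>N\<close> satisfies \<open>z \<rightarrow> z \<cdot> z = z\<close>, so the second factor is \<open>\<top>\<close>.\<close>

definition sep_term :: "nat \<Rightarrow> nat \<Rightarrow> nat \<Rightarrow> unary_hterm" where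
  "sep_term N c m = X \<^bold>\<cdot>
     (tpow (test_term N c m \<^bold>\<rightarrow> tpow X N) N \<^bold>\<cdot> (tpow X N \<^bold>\<rightarrow> tpow X N \<^bold>\<cdot> tpow X N) \<^bold>\<rightarrow> tpow X N)"

text \<open>Whatever the test yields, the antecedent of the outer implication is a multiple of z =
  \<open>a [^] N\<close>, hence below z, and the factor of \<open>X\<close> is \<top>.\<close>

lemma (in hoop) term_fun_sep_term_cancellative:
  assumes a: "a \<in> carrier A" and z: "a [^] N \<leadsto> a [^] N \<otimes> a [^] N = a [^] (N::nat)"
  shows "term_fun A (sep_term N c m) a = a"
proof -
  have "algebra A" by (rule hoop_algebra) (rule hoop_axioms)
  then have "term_fun A (tpow (test_term N c m \<^bold>\<rightarrow> tpow X N) N) a \<in> carrier A"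
    using a by (rule term_fun_closed)
  then show ?thesis
    using a z by (simp add: sep_term_def term_fun_tpow[of A X] mult_le)
qed

section \<open>Evaluation outside the radical\<close>

context
  fixes n N :: nat and a :: "int \<times> int"
  assumes a: "a \<in> carrier (S_lex n)" and a_lt: "fst a < int n" and N: "n < N"
begin

private lemma pow_a: "a [^]\<^bsub>S_lex n\<^esub> N = 0"
  using a a_lt N by (rule S_lex_pow_eq_0)

private lemma closed: "term_fun (S_lex n) t a \<in> carrier (S_lex n)"
  using hoop_algebra[OF hoop_S_lex] a by (rule term_fun_closed)

text \<open>First components obey truncated operations of their own, so second components can be
  ignored. Each step subtracts \<open>fst a\<close>, borrowing \<open>n\<close> when
  \<open>fst a\<close> is the larger.\<close>

lemma fst_term_fun_residue_term:
  "fst (term_fun (S_lex n) (residue_term N m) a) = (- (int m * fst a)) mod int n"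
proof (induction m)
  case 0
  then show ?case by (simp add: term_fun_tpow pow_a)
next
  case (Suc m)
  define r where "r = term_fun (S_lex n) (residue_term N m) a"
  have r: "r \<in> carrier (S_lex n)" unfolding r_def by (rule closed)
  have a0: "0 \<le> fst a" by (rule S_lex_carrierD[OF a])
  then have n: "0 < int n" using a_lt by linarith
  have fr: "fst r = (- (int m * fst a)) mod int n" using Suc by (simp add: r_def)
  then have r_bounds: "0 \<le> fst r" "fst r < int n" using n by auto
  have "(- (int (Suc m) * fst a)) mod int n = (fst r - fst a) mod int n"
  proof -
    have "- (int (Suc m) * fst a) = - (int m * fst a) - fst a" by (simp add: algebra_simps)
    then show ?thesis unfolding fr mod_diff_left_eq by (simp only:)
  qed
  also have "\<dots> = (if fst a \<le> fst r then fst r - fst a else fst r - fst a + int n)"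
  proof (cases "fst a \<le> fst r")
    case False
    have "(fst r - fst a) mod int n = (fst r - fst a + int n) mod int n" by simp
    also have "\<dots> = fst r - fst a + int n"
      using False r_bounds a0 a_lt by (intro mod_pos_pos_trivial) auto
    finally show ?thesis using False by simp
  qed (use r_bounds a0 in \<open>auto intro!: mod_pos_pos_trivial\<close>)
  finally have goal: "(- (int (Suc m) * fst a)) mod int n =
    (if fst a \<le> fst r then fst r - fst a else fst r - fst a + int n)" .
  define s where "s = a \<leadsto>\<^bsub>S_lex n\<^esub> r"
  have s: "s \<in> carrier (S_lex n)" using a r by (simp add: s_def)
  have fs: "fst s = min (int n - fst a + fst r) (int n)" by (simp add: s_def fst_S_lex)
  have step: "term_fun (S_lex n) (residue_term N (Suc m)) a =
    (r \<leadsto>\<^bsub>S_lex n\<^esub> a) \<leadsto>\<^bsub>S_lex n\<^esub> (s \<otimes>\<^bsub>S_lex n\<^esub> (s [^]\<^bsub>S_lex n\<^esub> N \<leadsto>\<^bsub>S_lex n\<^esub> 0))"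
    by (simp add: term_fun_tpow pow_a s_def r_def)
  \<comment> \<open>Without a borrow, \<open>s\<close> and its power are in the radical, the
    consequent has first component 0, and the implication leaves \<open>fst r - fst a\<close>. With
    a borrow, the power of \<open>s\<close> is 0, the consequent is \<open>s\<close>, and the
    antecedent has first component \<open>n\<close>.\<close>
  show ?case
  proof (cases "fst a \<le> fst r")
    case True
    then have "fst s = int n" using fs by simp
    then have "fst (s [^]\<^bsub>S_lex n\<^esub> N) = int n" by (rule fst_S_lex_pow_radical)
    then show ?thesis unfolding goal step using True \<open>fst s = int n\<close> a0 r_bounds by (simp add: fst_S_lex)
  next
    case False
    then have "fst s < int n" using fs by simp
    then have "s [^]\<^bsub>S_lex n\<^esub> N = 0" using s N by (intro S_lex_pow_eq_0)
    then show ?thesis unfolding goal step using False fs a0 a_lt r_bounds by (simp add: fst_S_lex)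
  qed
qed

lemma fst_term_fun_test_term:
  "fst (term_fun (S_lex n) (test_term N c m) a) =
    (if fst a = 0 \<and> 0 < c then int n else (- (int m * fst a)) mod int n)"
proof -
  define d where "d = (a \<leadsto>\<^bsub>S_lex n\<^esub> 0) [^]\<^bsub>S_lex n\<^esub> N \<leadsto>\<^bsub>S_lex n\<^esub> 0"
  have a0: "0 \<le> fst a" by (rule S_lex_carrierD[OF a])
  have *: "fst (term_fun (S_lex n) (test_term N c m) a) =
    min (int n - fst (d [^]\<^bsub>S_lex n\<^esub> c) + (- (int m * fst a)) mod int n) (int n)"
    by (simp add: test_term_def term_fun_tpow pow_a fst_S_lex fst_term_fun_residue_term flip: d_def)
  have ac: "a \<leadsto>\<^bsub>S_lex n\<^esub> 0 \<in> carrier (S_lex n)" using a S_lex_zero(1) by blast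
  have m: "0 \<le> (- (int m * fst a)) mod int n" "(- (int m * fst a)) mod int n \<le> int n"
    using a0 a_lt pos_mod_bound[of "int n"] by (auto intro: less_imp_le)
  show ?thesis
  proof (cases "fst a = 0")
    case True
    have "fst (a \<leadsto>\<^bsub>S_lex n\<^esub> 0) = int n" using True by (simp add: fst_S_lex)
    then have d: "fst d = 0" unfolding d_def using fst_S_lex_pow_radical[of "a \<leadsto>\<^bsub>S_lex n\<^esub> 0"]
      by (simp add: fst_S_lex)
    have dc: "d \<in> carrier (S_lex n)" unfolding d_def using ac S_lex_zero(1) by blast
    have "fst (d [^]\<^bsub>S_lex n\<^esub> c) = 0" if c: "0 < c"
    proof (cases c)
      case (Suc c')
      then show ?thesis using S_lex_carrierD[OF S_lex.nat_pow_closed[OF dc, of c']] d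
        by (simp add: fst_S_lex)
    qed (use c in simp)
    then show ?thesis using * m True by (cases "c = 0") (auto simp: fst_S_lex)
  next
    case False
    then have "fst (a \<leadsto>\<^bsub>S_lex n\<^esub> 0) < int n" using a0 a_lt by (simp add: fst_S_lex)
    then have "d = \<one>\<^bsub>S_lex n\<^esub>"
      unfolding d_def using S_lex_pow_eq_0[OF ac _ N] by (simp add: S_lex.resid_self S_lex_zero)
    then show ?thesis using * m False by (simp add: fst_S_lex)
  qed
qed

text \<open>Powers make the graded test two-valued. If its value \<open>e\<close> has positive first
  component, then \<open>q\<close>, a power of the negation of \<open>e\<close>, is exactly 0 and
  \<open>a\<close> is multiplied by \<top>. Otherwise \<open>q\<close> is in the radical, its
  negation has first component 0, and \<open>fst a < int n\<close> truncates the product to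
  0.\<close>

lemma term_fun_sep_term_nonradical:
  "term_fun (S_lex n) (sep_term N c m) a =
    (if (fst a = 0 \<and> 0 < c) \<or> \<not> int n dvd int m * fst a then a else 0)"
proof -
  define e where "e = term_fun (S_lex n) (test_term N c m) a"
  define q where "q = (e \<leadsto>\<^bsub>S_lex n\<^esub> 0) [^]\<^bsub>S_lex n\<^esub> N"
  have a0: "0 \<le> fst a" by (rule S_lex_carrierD[OF a])
  have e: "e \<in> carrier (S_lex n)" unfolding e_def by (rule closed)
  have ec: "e \<leadsto>\<^bsub>S_lex n\<^esub> 0 \<in> carrier (S_lex n)" using e S_lex_zero(1) by blast
  have q: "q \<in> carrier (S_lex n)" unfolding q_def using ec by blast
  have t: "term_fun (S_lex n) (sep_term N c m) a = a \<otimes>\<^bsub>S_lex n\<^esub> (q \<leadsto>\<^bsub>S_lex n\<^esub> 0)"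
    using q by (simp add: sep_term_def term_fun_tpow pow_a S_lex_zero q_def e_def)
  have fe: "0 < fst e \<longleftrightarrow> (fst a = 0 \<and> 0 < c) \<or> \<not> int n dvd int m * fst a"
  proof -
    define r where "r = (- (int m * fst a)) mod int n"
    have "0 \<le> r" unfolding r_def using a0 a_lt by (intro pos_mod_sign) simp
    moreover have "r = 0 \<longleftrightarrow> int n dvd - (int m * fst a)"
      unfolding r_def by (rule dvd_eq_mod_eq_0[symmetric])
    ultimately have "0 < r \<longleftrightarrow> \<not> int n dvd int m * fst a" unfolding dvd_minus_iff by linarith
    then show ?thesis
      using a0 a_lt unfolding e_def fst_term_fun_test_term r_def[symmetric] by auto
  qed
  show ?thesis
  proof (cases "0 < fst e")
    case True
    then have "fst (e \<leadsto>\<^bsub>S_lex n\<^esub> 0) < int n" by (simp add: fst_S_lex)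
    then have "q = 0" unfolding q_def using ec N by (intro S_lex_pow_eq_0)
    then show ?thesis using t a True fe by (simp add: S_lex.resid_self S_lex_zero)
  next
    case False
    then have "fst e = 0" using S_lex_carrierD(1)[OF e] by simp
    then have "fst (e \<leadsto>\<^bsub>S_lex n\<^esub> 0) = int n" by (simp add: fst_S_lex)
    then have "fst q = int n" unfolding q_def by (rule fst_S_lex_pow_radical)
    then have "a \<otimes>\<^bsub>S_lex n\<^esub> (q \<leadsto>\<^bsub>S_lex n\<^esub> 0) = 0"
      using a_lt by (intro S_lex_mult_eq_0) (simp add: fst_S_lex)
    then show ?thesis using t False unfolding fe by (simp only: if_False)
  qed
qed

end

lemma term_fun_sep_term:
  assumes a: "a \<in> carrier (S_lex n)" and n: "0 < n" and N: "n < N"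
  shows "term_fun (S_lex n) (sep_term N c m) a =
    (if fst a = int n \<or> (fst a = 0 \<and> 0 < c) \<or> \<not> int n dvd int m * fst a then a else 0)"
proof (cases "fst a = int n")
  case True
  then have "fst (a [^]\<^bsub>S_lex n\<^esub> N) = int n" by (rule fst_S_lex_pow_radical)
  then show ?thesis
    using S_lex.term_fun_sep_term_cancellative[OF a] S_lex_radical_resid[of "a [^]\<^bsub>S_lex n\<^esub> N" n] a n True
    by simp
next
  case False
  then show ?thesis using term_fun_sep_term_nonradical[OF a _ N] S_lex_carrierD(2)[OF a] by simp
qed

text \<open>Coprimality would make \<open>n\<close> divide \<open>fst a\<close>, which lies strictly
  between 0 and \<open>n\<close>.\<close>

lemma not_dvd_mult_coprime:
  assumes "coprime n m" "a \<in> carrier (S_lex n)" "fst a \<noteq> int n" "fst a \<noteq> 0"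
  shows "\<not> int n dvd int m * fst a"
  using assms S_lex_carrierD[OF assms(2)]
  by (auto simp: coprime_dvd_mult_right_iff zdvd_not_zless)

text \<open>At first component 0 divisibility always holds, so \<open>c\<close> decides: these
  elements must survive for \<open>J\<^sub>1\<close> and become 0 for \<open>J\<^sub>2\<close>. In
  \<open>S i\<close> the only such element is 0, where both outcomes agree. At other elements off
  the radical, coprimality makes the test succeed and divisibility makes it fail.\<close>

lemma separation_term_sep_term:
  assumes pos: "\<And>p. p \<in> I\<^sub>1 \<union> I\<^sub>2 \<union> J\<^sub>1 \<union> J\<^sub>2 \<Longrightarrow> 0 < p \<and> p < N"
    and coprime: "\<And>p. p \<in> I\<^sub>1 \<union> J\<^sub>1 \<Longrightarrow> coprime p m"
    and dvd: "\<And>p. p \<in> I\<^sub>2 \<union> J\<^sub>2 \<Longrightarrow> p dvd m"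
    and c: "J\<^sub>1 \<noteq> {} \<Longrightarrow> 0 < c" "J\<^sub>2 \<noteq> {} \<Longrightarrow> c = 0"
  shows "separation_term K I\<^sub>1 I\<^sub>2 J\<^sub>1 J\<^sub>2 (sep_term N c m)"
  unfolding separation_term_def
proof (intro conjI ballI impI)
  fix i assume i: "i \<in> I\<^sub>1"
  show "S i \<Turnstile> sep_term N c m \<approx> X"
  proof (rule S_unary_satisfies)
    fix k assume "k \<le> i"
    then show "term_fun (S_lex i) (sep_term N c m) (int k, 0) = term_fun (S_lex i) X (int k, 0)"
      using term_fun_sep_term[OF S_point_in_S_lex, of k i N c m] pos[of i] i
        not_dvd_mult_coprime[OF coprime S_point_in_S_lex, of i k]
      by (auto simp: zero_prod_def)
  qed (use pos i in auto)
next
  fix j assume j: "j \<in> J\<^sub>1"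
  then have "0 < j" "j < N" "coprime j m" "0 < c" using pos[of j] coprime[of j] c by auto
  then show "S_lex j \<Turnstile> sep_term N c m \<approx> X"
    unfolding satisfies_unary_iff
    by (intro ballI) (metis term_fun_sep_term not_dvd_mult_coprime term_fun_simps(1))
next
  fix i assume i: "i \<in> I\<^sub>2"
  have dvd_i: "int i dvd int m * x" for x using dvd[of i] i by simp
  show "S i \<Turnstile> sep_term N c m \<approx> tpow X i"
  proof (rule S_unary_satisfies)
    fix k assume k: "k \<le> i"
    have i0: "0 < i" "i < N" using pos[of i] i by auto
    have "term_fun (S_lex i) (tpow X i) (int i, 0) = (int i, 0)"
      using S_lex.nat_pow_one[of i i] by (simp add: term_fun_tpow S_lex_simps(2))
    then show "term_fun (S_lex i) (sep_term N c m) (int k, 0) = term_fun (S_lex i) (tpow X i) (int k, 0)"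
      using term_fun_sep_term[OF S_point_in_S_lex[OF k] i0] S_lex_point_pow[OF i0(1), of k] k dvd_i
      by (cases "k = i") (auto simp: zero_prod_def)
  qed (use pos i in auto)
next
  fix j assume j: "j \<in> J\<^sub>2"
  then have "c = 0" "j dvd m" "0 < j" "j < N" using pos[of j] dvd[of j] c by auto
  then show "S_lex j \<Turnstile> sep_term N c m \<approx>
      X \<^bold>\<cdot> ((tpow X (j + 1) \<^bold>\<rightarrow> tpow X (2 * (j + 1))) \<^bold>\<rightarrow> tpow X (j + 1))"
    unfolding satisfies_unary_iff
    by (auto simp only: term_fun_sep_term term_fun_radical_part)
      (simp_all add: radical_part_def)
next
  interpret hoop "S\<^sup>\<omega>" by (rule hoop_S_cancel)
  show "S\<^sup>\<omega> \<Turnstile> sep_term N c m \<approx> X"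
    unfolding satisfies_unary_iff by (simp add: term_fun_sep_term_cancellative)
qed

text \<open>On each generator the prescribed identities make \<open>t\<close> the identity, the
  indicator of 1 or the radical part.\<close>

lemma separation_term_conucleus:
  assumes IJK: "reduced_triple I J K" and sep: "multiplicative_separation I J I\<^sub>1 I\<^sub>2 J\<^sub>1 J\<^sub>2"
    and t: "separation_term K I\<^sub>1 I\<^sub>2 J\<^sub>1 J\<^sub>2 t" and A: "A \<in> \<V> I J K"
  shows "multiplicative_conucleus A (term_fun A t)"
  using A
proof (rule variety_conucleus)
  fix i assume "i \<in> I"
  then have i: "0 < i" "i \<in> I\<^sub>1 \<union> I\<^sub>2"
    using IJK sep by (auto simp: reduced_triple_def multiplicative_separation_def)
  interpret hoop "S i" using i(1) by (rule hoop_S)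
  show "multiplicative_conucleus (S i) (term_fun (S i) t)"
  proof (cases "i \<in> I\<^sub>1")
    case True
    then show ?thesis
      using t by (intro multiplicative_conucleus_id) (auto simp: separation_term_def satisfies_unary_iff)
  next
    case False
    then show ?thesis
      using t i by (intro multiplicative_conucleus_S_pow)
        (auto simp: separation_term_def satisfies_unary_iff S_pow)
  qed
next
  fix j assume "j \<in> J"
  then have j: "0 < j" "j \<in> J\<^sub>1 \<union> J\<^sub>2"
    using IJK sep by (auto simp: reduced_triple_def multiplicative_separation_def)
  show "multiplicative_conucleus (S_lex j) (term_fun (S_lex j) t)"
  proof (cases "j \<in> J\<^sub>1")
    case True
    then show ?thesis
      using t by (intro S_lex.multiplicative_conucleus_id)
        (auto simp: separation_term_def satisfies_unary_iff)
  next
    case False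
    then show ?thesis
      using t j by (intro multiplicative_conucleus_radical_part)
        (auto simp only: separation_term_def satisfies_unary_iff term_fun_radical_part Un_iff)
  qed
next
  assume "K = {0}"
  then show "multiplicative_conucleus S\<^sup>\<omega> (term_fun S\<^sup>\<omega> t)"
    using t by (intro hoop.multiplicative_conucleus_id hoop_S_cancel)
      (auto simp: separation_term_def satisfies_unary_iff)
qed

section \<open>Computability\<close>

lemma total_recursive_comp1:
  assumes "total_recursive 1 (\<lambda>xs. h (xs ! 0))" "total_recursive n f"
  shows "total_recursive n (\<lambda>xs. h (f xs))"
  using comp[of "[f]" "\<lambda>xs. h (xs ! 0)" n] assms by simp

lemma total_recursive_comp2:
  assumes "total_recursive 2 (\<lambda>xs. h (xs ! 0) (xs ! 1))" "total_recursive n f" "total_recursive n g"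
  shows "total_recursive n (\<lambda>xs. h (f xs) (g xs))"
  using comp[of "[f, g]" "\<lambda>xs. h (xs ! 0) (xs ! 1)" n] assms by (auto simp: numeral_2_eq_2)

lemma total_recursive_Suc:
  "total_recursive n f \<Longrightarrow> total_recursive n (\<lambda>xs. Suc (f xs))"
  by (rule total_recursive_comp1[OF succ])

lemma total_recursive_const: "total_recursive n (\<lambda>xs. c)"
  by (induction c) (auto intro: zero total_recursive_Suc)

text \<open>Recursion with one parameter, freed from argument lists; \<open>g\<close> receives the
  counter, the previous value and the parameter.\<close>

lemma total_recursive_rec:
  assumes "total_recursive 1 (\<lambda>xs. f (xs ! 0))"
    and "total_recursive 3 (\<lambda>xs. g (xs ! 0) (xs ! 1) (xs ! 2))"
    and "total_recursive n m" "total_recursive n p"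
  shows "total_recursive n (\<lambda>xs. rec_nat (f (p xs)) (\<lambda>k r. g k r (p xs)) (m xs))"
proof -
  have "total_recursive (Suc 1) (\<lambda>xs. rec_nat (f (tl xs ! 0))
      (\<lambda>k r. g ((k # r # tl xs) ! 0) ((k # r # tl xs) ! 1) ((k # r # tl xs) ! 2)) (hd xs))"
    using assms(1,2) by (intro prec) (simp_all add: numeral_3_eq_3)
  then have "total_recursive 2 (\<lambda>xs. rec_nat (f (tl xs ! 0))
      (\<lambda>k r. g ((k # r # tl xs) ! 0) ((k # r # tl xs) ! 1) ((k # r # tl xs) ! 2)) (hd xs))"
    by (simp add: numeral_2_eq_2)
  then have "total_recursive 2 (\<lambda>xs. rec_nat (f (xs ! 1)) (\<lambda>k r. g k r (xs ! 1)) (xs ! 0))"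
    by (rule ext) (auto simp: length_Suc_conv numeral_2_eq_2)
  from total_recursive_comp2[OF this assms(3,4)] show ?thesis .
qed

named_theorems total_recursive_intros

declare total_recursive_Suc [total_recursive_intros] total_recursive_const [total_recursive_intros]

lemma total_recursive_proj [total_recursive_intros]:
  "total_recursive 1 (\<lambda>xs. xs ! 0)"
  "total_recursive (Suc 0) (\<lambda>xs. xs ! 0)" "total_recursive 3 (\<lambda>xs. xs ! 0)"
  "total_recursive 3 (\<lambda>xs. xs ! Suc 0)" "total_recursive 3 (\<lambda>xs. xs ! 2)"
  by (auto intro: proj)

lemma total_recursive_add [total_recursive_intros]:
  assumes "total_recursive n f" "total_recursive n g"
  shows "total_recursive n (\<lambda>xs. f xs + g xs)"
proof -
  have "rec_nat p (\<lambda>_ r. Suc r) m = m + p" for m p by (induction m) auto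
  then show ?thesis
    using total_recursive_rec[of "\<lambda>p. p" "\<lambda>_ r _. Suc r", OF _ _ assms]
    by (simp add: total_recursive_intros)
qed

lemma total_recursive_mult [total_recursive_intros]:
  assumes "total_recursive n f" "total_recursive n g"
  shows "total_recursive n (\<lambda>xs. f xs * g xs)"
proof -
  have "rec_nat 0 (\<lambda>_ r. r + p) m = m * p" for m p :: nat by (induction m) auto
  then show ?thesis
    using total_recursive_rec[of "\<lambda>_. 0" "\<lambda>_ r p. r + p", OF _ _ assms]
    by (simp add: total_recursive_intros)
qed

lemma total_recursive_if [total_recursive_intros]:
  assumes "total_recursive n f" "total_recursive n g" "total_recursive n h"
  shows "total_recursive n (\<lambda>xs. if f xs = 0 then g xs else h xs)"
proof -
  \<comment> \<open>\<open>z\<close> is the indicator of 0 and its double application that of the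
    positive numbers, so the conditional is a sum of products.\<close>
  define z :: "nat \<Rightarrow> nat" where "z m = rec_nat 1 (\<lambda>_ _. 0) m" for m
  have z: "total_recursive n (\<lambda>xs. z (k xs))" if "total_recursive n k" for k
    unfolding z_def using total_recursive_rec[of "\<lambda>_. 1" "\<lambda>_ _ _. 0" n k k] that
    by (simp add: total_recursive_intros)
  have "(if f xs = 0 then g xs else h xs) = z (f xs) * g xs + z (z (f xs)) * h xs" for xs
    by (cases "f xs") (auto simp: z_def)
  then show ?thesis by (simp add: total_recursive_intros z assms)
qed

lemma total_recursive_parity [total_recursive_intros]:
  assumes "total_recursive n f"
  shows "total_recursive n (\<lambda>xs. f xs mod 2)"
proof -
  have "rec_nat 0 (\<lambda>_ r. if r = 0 then 1 else 0) m = m mod 2" for m :: nat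
    by (induction m) (auto simp: mod_Suc)
  then show ?thesis
    using total_recursive_rec[of "\<lambda>_. 0" "\<lambda>_ r _. if r = 0 then 1 else 0", OF _ _ assms assms]
    by (simp add: total_recursive_intros)
qed

lemma total_recursive_half [total_recursive_intros]:
  assumes "total_recursive n f"
  shows "total_recursive n (\<lambda>xs. f xs div 2)"
proof -
  have "rec_nat 0 (\<lambda>k r. r + k mod 2) m = m div 2" for m :: nat
    by (induction m) (auto, presburger)
  then show ?thesis
    using total_recursive_rec[of "\<lambda>_. 0" "\<lambda>k r _. r + k mod 2", OF _ _ assms assms]
    by (simp add: total_recursive_intros)
qed

lemma total_recursive_div_power_2 [total_recursive_intros]:
  assumes "total_recursive n f" "total_recursive n g"
  shows "total_recursive n (\<lambda>xs. f xs div 2 ^ g xs)"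
proof -
  have "rec_nat p (\<lambda>_ r. r div 2) m = p div 2 ^ m" for m p :: nat
    by (induction m) (auto simp: div_mult2_eq mult.commute simp flip: div_mult2_eq)
  then show ?thesis
    using total_recursive_rec[of "\<lambda>p. p" "\<lambda>_ r _. r div 2", OF _ _ assms(2,1)]
    by (simp add: total_recursive_intros)
qed

text \<open>Membership of i is the i-th binary digit of the code c, so the recursion runs through
  the digits. Stopping at c loses nothing, as i < 2^i \<le> c for each member.\<close>

lemma total_recursive_prod_set_decode [total_recursive_intros]:
  assumes "total_recursive n f"
  shows "total_recursive n (\<lambda>xs. \<Prod>(set_decode (f xs)))"
proof -
  have *: "rec_nat 1 (\<lambda>i r. r * (if (c div 2 ^ i) mod 2 = 0 then 1 else i)) m = \<Prod>{i \<in> set_decode c. i < m}"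
    for c m
  proof (induction m)
    case (Suc m)
    have "{i \<in> set_decode c. i < Suc m} =
        (if m \<in> set_decode c then insert m {i \<in> set_decode c. i < m} else {i \<in> set_decode c. i < m})"
      by (auto simp: less_Suc_eq)
    then show ?case using Suc by (auto simp: set_decode_def even_iff_mod_2_eq_zero)
  qed simp
  have "i < c" if "i \<in> set_decode c" for i c
  proof (rule ccontr)
    assume "\<not> i < c"
    then have "c < 2 ^ i" using less_exp[of i] by linarith
    then show False using that by (simp add: set_decode_def)
  qed
  then have "{i \<in> set_decode c. i < c} = set_decode c" for c by auto
  then show ?thesis
    using total_recursive_rec[of "\<lambda>_. 1" "\<lambda>i r c. r * (if (c div 2 ^ i) mod 2 = 0 then 1 else i)",
        OF _ _ assms assms]
    unfolding * by (simp add: total_recursive_intros)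
qed

lemma total_recursive_prod_encode [total_recursive_intros]:
  assumes "total_recursive n f" "total_recursive n g"
  shows "total_recursive n (\<lambda>xs. prod_encode (f xs, g xs))"
proof -
  have "rec_nat 0 (\<lambda>k r. r + Suc k) m = triangle m" for m
    by (induction m) auto
  then have "total_recursive n (\<lambda>xs. triangle (f xs + g xs))"
    using total_recursive_rec[of "\<lambda>_. 0" "\<lambda>k r _. r + Suc k" n "\<lambda>xs. f xs + g xs" f] assms
    by (simp add: total_recursive_intros)
  then show ?thesis
    using assms by (simp add: prod_encode_def total_recursive_intros)
qed

section \<open>Goedel codes of the separation terms\<close>

definition mult_code :: "nat \<Rightarrow> nat \<Rightarrow> nat" where
  "mult_code a b = 2 * prod_encode (a, b) + 2"

definition imp_code :: "nat \<Rightarrow> nat \<Rightarrow> nat" where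
  "imp_code a b = 2 * prod_encode (a, b) + 3"

text \<open>The start value 1 is the code of \<open>Top\<close>.\<close>

definition pow_code :: "nat \<Rightarrow> nat \<Rightarrow> nat" where
  "pow_code a k = rec_nat 1 (\<lambda>_ r. mult_code r a) k"

text \<open>The recursion mirrors \<open>residue_term\<close>, with 0 as the code of
  \<open>X\<close>.\<close>

definition residue_code :: "nat \<Rightarrow> nat \<Rightarrow> nat" where
  "residue_code N m = rec_nat (pow_code 0 N)
     (\<lambda>_ r. imp_code (imp_code r 0)
        (mult_code (imp_code 0 r) (imp_code (pow_code (imp_code 0 r) N) (pow_code 0 N)))) m"

lemma term_code_tpow: "term_code (tpow t k) = pow_code (term_code t) k"
  by (induction k) (simp_all add: pow_code_def mult_code_def)

lemma term_code_residue_term: "term_code (residue_term N m) = residue_code N m"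
  by (induction m) (simp_all add: residue_code_def imp_code_def mult_code_def term_code_tpow)

lemma total_recursive_codes [total_recursive_intros]:
  assumes "total_recursive n f" "total_recursive n g"
  shows "total_recursive n (\<lambda>xs. mult_code (f xs) (g xs))"
    and "total_recursive n (\<lambda>xs. imp_code (f xs) (g xs))"
  using assms by (simp_all add: mult_code_def imp_code_def total_recursive_intros)

lemma total_recursive_pow_code [total_recursive_intros]:
  assumes "total_recursive n f" "total_recursive n g"
  shows "total_recursive n (\<lambda>xs. pow_code (f xs) (g xs))"
  using total_recursive_rec[of "\<lambda>_. 1" "\<lambda>_ r a. mult_code r a", OF _ _ assms(2,1)]
  by (simp add: pow_code_def total_recursive_intros)

lemma total_recursive_residue_code [total_recursive_intros]:
  assumes "total_recursive n f" "total_recursive n g"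
  shows "total_recursive n (\<lambda>xs. residue_code (f xs) (g xs))"
  using total_recursive_rec[of "\<lambda>N. pow_code 0 N" "\<lambda>_ r N. imp_code (imp_code r 0)
        (mult_code (imp_code 0 r) (imp_code (pow_code (imp_code 0 r) N) (pow_code 0 N)))",
      OF _ _ assms(2,1)]
  by (simp add: residue_code_def total_recursive_intros)

lemma total_recursive_sep_term:
  assumes "total_recursive n f" "total_recursive n g" "total_recursive n h"
  shows "total_recursive n (\<lambda>xs. term_code (sep_term (f xs) (g xs) (h xs)))"
  using assms
  by (simp add: sep_term_def test_term_def term_code_tpow term_code_residue_term total_recursive_intros)

text \<open>The code of a set thus serves as a computable exponent exceeding all its
  members.\<close>

lemma less_set_encode: assumes "finite A" "i \<in> A" shows "i < set_encode A"
proof -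
  have "i < 2 ^ i" by (rule less_exp)
  also have "\<dots> \<le> set_encode A"
    unfolding set_encode_def using assms by (intro member_le_sum) auto
  finally show ?thesis .
qed

theorem theorem5p7:
  shows "(\<exists>F. total_recursive 7 F \<and>
           (\<forall>I J K I\<^sub>1 I\<^sub>2 J\<^sub>1 J\<^sub>2.
              reduced_triple I J K \<longrightarrow> multiplicative_separation I J I\<^sub>1 I\<^sub>2 J\<^sub>1 J\<^sub>2 \<longrightarrow>
              (\<exists>t. F [set_encode I, set_encode J, set_encode K,
                      set_encode I\<^sub>1, set_encode I\<^sub>2, set_encode J\<^sub>1, set_encode J\<^sub>2] = term_code t \<and>
                   separation_term K I\<^sub>1 I\<^sub>2 J\<^sub>1 J\<^sub>2 t))) \<and>
         (\<forall>I J K I\<^sub>1 I\<^sub>2 J\<^sub>1 J\<^sub>2 t.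
            reduced_triple I J K \<longrightarrow> multiplicative_separation I J I\<^sub>1 I\<^sub>2 J\<^sub>1 J\<^sub>2 \<longrightarrow>
            separation_term K I\<^sub>1 I\<^sub>2 J\<^sub>1 J\<^sub>2 t \<longrightarrow>
            (\<forall>A :: 'a hoop_alg. A \<in> \<V> I J K \<longrightarrow> multiplicative_conucleus A (term_fun A t)))"
proof (rule conjI)
  \<comment> \<open>\<open>N\<close> is the sum of the codes of \<open>I\<close> and
    \<open>J\<close>, above all their members. \<open>c\<close> is the code of
    \<open>J\<^sub>1\<close>, positive exactly when that set is nonempty. \<open>m\<close> is the
    product over \<open>I\<^sub>2\<close> times the product over \<open>J\<^sub>2\<close>.\<close>
  define F where "F xs = term_code (sep_term (xs ! 0 + xs ! 1) (xs ! 5)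
    (\<Prod>(set_decode (xs ! 4)) * \<Prod>(set_decode (xs ! 6))))" for xs
  have "total_recursive 7 F"
    unfolding F_def
    by (intro total_recursive_sep_term total_recursive_add total_recursive_mult
        total_recursive_prod_set_decode proj) simp_all
  moreover have "\<exists>t. F [set_encode I, set_encode J, set_encode K,
      set_encode I\<^sub>1, set_encode I\<^sub>2, set_encode J\<^sub>1, set_encode J\<^sub>2] = term_code t \<and>
      separation_term K I\<^sub>1 I\<^sub>2 J\<^sub>1 J\<^sub>2 t"
    if IJK: "reduced_triple I J K" and sep: "multiplicative_separation I J I\<^sub>1 I\<^sub>2 J\<^sub>1 J\<^sub>2"
    for I J K I\<^sub>1 I\<^sub>2 J\<^sub>1 J\<^sub>2
  proof -
    have fin: "finite I" "finite J" and pos: "\<forall>p \<in> I \<union> J. 0 < p"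
      using IJK by (auto simp: reduced_triple_def)
    have sub: "I\<^sub>1 \<subseteq> I" "I\<^sub>2 \<subseteq> I" "J\<^sub>1 \<subseteq> J" "J\<^sub>2 \<subseteq> J"
      and cop: "\<And>k l. k \<in> I\<^sub>1 \<union> J\<^sub>1 \<Longrightarrow> l \<in> I\<^sub>2 \<union> J\<^sub>2 \<Longrightarrow> coprime k l"
      and J12: "J\<^sub>1 = {} \<or> J\<^sub>2 = {}"
      using sep by (auto simp: multiplicative_separation_def coprime_iff_gcd_eq_1)
    have fin': "finite I\<^sub>2" "finite J\<^sub>1" "finite J\<^sub>2" using sub fin by (auto intro: finite_subset)
    have "separation_term K I\<^sub>1 I\<^sub>2 J\<^sub>1 J\<^sub>2
      (sep_term (set_encode I + set_encode J) (set_encode J\<^sub>1) (\<Prod>I\<^sub>2 * \<Prod>J\<^sub>2))"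
    proof (rule separation_term_sep_term)
      fix p assume "p \<in> I\<^sub>1 \<union> I\<^sub>2 \<union> J\<^sub>1 \<union> J\<^sub>2"
      then have "p \<in> I \<or> p \<in> J" using sub by blast
      then show "0 < p \<and> p < set_encode I + set_encode J"
        using pos less_set_encode[OF fin(1), of p] less_set_encode[OF fin(2), of p] by auto
    next
      fix p assume "p \<in> I\<^sub>1 \<union> J\<^sub>1"
      then show "coprime p (\<Prod>I\<^sub>2 * \<Prod>J\<^sub>2)"
        using cop by (auto simp: coprime_mult_right_iff intro!: prod_coprime_right)
    next
      fix p assume "p \<in> I\<^sub>2 \<union> J\<^sub>2"
      then show "p dvd \<Prod>I\<^sub>2 * \<Prod>J\<^sub>2"
        using fin' dvd_prodI[of I\<^sub>2 p "\<lambda>i. i"] dvd_prodI[of J\<^sub>2 p "\<lambda>i. i"] by auto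
    next
      assume "J\<^sub>1 \<noteq> {}"
      then show "0 < set_encode J\<^sub>1" using less_set_encode[OF fin'(2)] by fastforce
    next
      assume "J\<^sub>2 \<noteq> {}"
      then show "set_encode J\<^sub>1 = 0" using J12 by simp
    qed
    then show ?thesis using fin' by (auto simp: F_def)
  qed
  ultimately show "\<exists>F. total_recursive 7 F \<and>
      (\<forall>I J K I\<^sub>1 I\<^sub>2 J\<^sub>1 J\<^sub>2.
        reduced_triple I J K \<longrightarrow> multiplicative_separation I J I\<^sub>1 I\<^sub>2 J\<^sub>1 J\<^sub>2 \<longrightarrow>
        (\<exists>t. F [set_encode I, set_encode J, set_encode K,
                set_encode I\<^sub>1, set_encode I\<^sub>2, set_encode J\<^sub>1, set_encode J\<^sub>2] = term_code t \<and>
             separation_term K I\<^sub>1 I\<^sub>2 J\<^sub>1 J\<^sub>2 t))"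
    by blast
qed (blast intro: separation_term_conucleus)

end
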